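(* Let $n,k,s$ be positive integers. If $n\ge 2k^2(k-1)+(s-1)k(k-1)+1$, then $\chi_c(\operatorname{KG}_s(n,k))=\chi(\operatorname{KG}_s(n,k))$.
   Context: $[n]=\{1,\dots,n\}$. A nonempty subset $\mathcal{S}\subseteq[n]$ is $s$-stable if for any two different $i,j\in\mathcal{S}$, $s\le|i-j|\le n-s$. $\operatorname{KG}_s(n,k)$ has as vertices all $s$-stable $k$-subsets of $[n]$, two adjacent iff disjoint. For positive integers $p,d$, $K_{p/d}$ has vertex set $[p]$ with $i,j$ adjacent iff $d\le|i-j|\le p-d$; $\chi_c(G)$ is the infimum of $p/d$ over all $p,d$ admitting a homomorphism $G\to K_{p/d}$.
   Formalization: The infimum defining the circular chromatic number is taken only over p/d with d ≤ p; this changes nothing for graphs with an edge, but without it the claim fails for n = k = 1, where K_1 maps to every K_{1/d} and the infimum would be 0 instead of 1. *)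

theory Defs
  imports Complex_Main "Graph_Theory.Pair_Digraph"
begin

text \<open>
  Finite simple graphs are values of type \<^typ>\<open>'a pair_pre_digraph\<close> satisfying the
  locale \<^locale>\<open>pair_graph\<close> (finite, symmetric, loop-free): an edge is
  represented by the two arcs joining its endpoints.
\<close>

definition graph_hom :: "('a \<Rightarrow> 'b) \<Rightarrow> 'a pair_pre_digraph \<Rightarrow> 'b pair_pre_digraph \<Rightarrow> bool" where
  "graph_hom f G H \<longleftrightarrow>
     f ` pverts G \<subseteq> pverts H \<and> (\<forall>(u, v) \<in> parcs G. (f u, f v) \<in> parcs H)"

definition proper_coloring :: "('a \<Rightarrow> nat) \<Rightarrow> 'a pair_pre_digraph \<Rightarrow> nat \<Rightarrow> bool" where
  "proper_coloring f G c \<longleftrightarrow>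
     f ` pverts G \<subseteq> {1..c} \<and> (\<forall>(u, v) \<in> parcs G. f u \<noteq> f v)"

definition chromatic_number :: "'a pair_pre_digraph \<Rightarrow> nat" where
  "chromatic_number G = (LEAST c. \<exists>f. proper_coloring f G c)"

text \<open>
  Absolute differences of vertex labels are taken in \<^typ>\<open>int\<close>, so that neither
  \<open>i - j\<close> nor \<open>n - s\<close> is truncated.
\<close>

definition circular_clique :: "nat \<Rightarrow> nat \<Rightarrow> nat pair_pre_digraph" where
  "circular_clique p d =
     \<lparr> pverts = {1..p},
       parcs = {(i, j). i \<in> {1..p} \<and> j \<in> {1..p} \<and>
                  int d \<le> \<bar>int i - int j\<bar> \<and> \<bar>int i - int j\<bar> \<le> int p - int d} \<rparr>"

text \<open>
  The fractions \<open>p/d\<close> are required to satisfy \<open>d \<le> p\<close>. For a graph with at least one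
  edge this changes nothing (lemma \<open>circular_chromatic_number_unrestricted\<close> below). It only
  matters for graphs without edges: such a graph maps to the one-vertex graph
  \<open>circular_clique 1 d\<close> for every \<open>d\<close>, so without the restriction the infimum
  would be \<open>0\<close>, whereas with it a nonempty edgeless graph has the expected value \<open>1\<close>.
\<close>

definition circular_chromatic_number :: "'a pair_pre_digraph \<Rightarrow> real" where
  "circular_chromatic_number G =
     Inf {real p / real d | p d. 0 < d \<and> d \<le> p \<and> (\<exists>f. graph_hom f G (circular_clique p d))}"

definition stable_set :: "nat \<Rightarrow> nat \<Rightarrow> nat set \<Rightarrow> bool" where
  "stable_set s n S \<longleftrightarrow>
     S \<noteq> {} \<and> S \<subseteq> {1..n} \<and>
     (\<forall>i\<in>S. \<forall>j\<in>S. i \<noteq> j \<longrightarrow>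
        int s \<le> \<bar>int i - int j\<bar> \<and> \<bar>int i - int j\<bar> \<le> int n - int s)"

definition stable_kneser_verts :: "nat \<Rightarrow> nat \<Rightarrow> nat \<Rightarrow> nat set set" where
  "stable_kneser_verts s n k = {S. stable_set s n S \<and> card S = k}"

definition stable_kneser_graph :: "nat \<Rightarrow> nat \<Rightarrow> nat \<Rightarrow> nat set pair_pre_digraph" where
  "stable_kneser_graph s n k =
     \<lparr> pverts = stable_kneser_verts s n k,
       parcs = {(A, B). A \<in> stable_kneser_verts s n k \<and> B \<in> stable_kneser_verts s n k \<and>
                  A \<inter> B = {}} \<rparr>"

lemma pair_graph_stable_kneser_graph: "pair_graph (stable_kneser_graph s n k)"
proof -
  have "stable_kneser_verts s n k \<subseteq> Pow {1..n}"
    by (auto simp: stable_kneser_verts_def stable_set_def)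
  then have fin: "finite (stable_kneser_verts s n k)"
    by (rule finite_subset) simp
  have "finite (parcs (stable_kneser_graph s n k))"
    by (rule finite_subset[OF _ finite_cartesian_product[OF fin fin]])
      (auto simp: stable_kneser_graph_def)
  with fin show ?thesis
    by unfold_locales
      (auto simp: stable_kneser_graph_def symmetric_def sym_def,
       auto simp: stable_kneser_verts_def stable_set_def)
qed

lemma pair_graph_circular_clique:
  assumes "0 < d"
  shows "pair_graph (circular_clique p d)"
proof -
  have "finite (parcs (circular_clique p d))"
    by (rule finite_subset[of _ "{1..p} \<times> {1..p}"]) (auto simp: circular_clique_def)
  with assms show ?thesis
    by unfold_locales (auto simp: circular_clique_def symmetric_def sym_def abs_minus_commute)
qed

lemma circular_chromatic_number_unrestricted:
  fixes G :: "'a pair_pre_digraph"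
  assumes "parcs G \<noteq> {}"
  shows "circular_chromatic_number G =
    Inf {real p / real d | p d. 0 < p \<and> 0 < d \<and> (\<exists>f. graph_hom f G (circular_clique p d))}"
proof -
  have "d \<le> p" if "graph_hom f G (circular_clique p d)" for f :: "'a \<Rightarrow> nat" and p d
  proof -
    from assms obtain u v where "(u, v) \<in> parcs G"
      by auto
    with that have "(f u, f v) \<in> parcs (circular_clique p d)"
      by (auto simp: graph_hom_def)
    then show ?thesis
      by (auto simp: circular_clique_def)
  qed
  then have "{real p / real d | p d. 0 < d \<and> d \<le> p \<and> (\<exists>f. graph_hom f G (circular_clique p d))} =
    {real p / real d | p d. 0 < p \<and> 0 < d \<and> (\<exists>f. graph_hom f G (circular_clique p d))}"
    by (intro Collect_cong) (metis less_le_trans)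
  then show ?thesis
    by (simp add: circular_chromatic_number_def)
qed

end

(* Suppose the graph G, with chromatic number t, maps to K_(p/d) with p < t d. Cutting the circle
   into t intervals of length at most d gives t intersecting families. Let u be the maximal number
   of vertices containing two prescribed elements. A family that is not a star has at most 2 k u
   members, by the classical covering argument. A star with centre i has at most 2 k u members too:
   going round the circle in either direction, the first vertices that avoid i are, say, A and B;
   every member of the star meets A or B, since otherwise all vertices avoiding i would lie on
   an arc so short that G could be coloured with t - 1 colours. But G has more than 2 k t u vertices:
   exchanging one element bounds the number of vertices containing j + 1 prescribed
   elements by a small multiple of the number containing j of them, rotations make the number
   containing one prescribed element constant, and t <= n - s (k - 1) by colouring each
   vertex with its minimum. *)

theory Submission
  imports Defs
begin

section \<open>Intersecting families\<close>

lemma card_le_of_cover: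
  assumes "finite I" "card I \<le> m" "\<And>b. b \<in> I \<Longrightarrow> finite (F b)"
    and "\<And>b. b \<in> I \<Longrightarrow> card (F b) \<le> u" and "W \<subseteq> (\<Union>b\<in>I. F b)"
  shows "card W \<le> m * (u::nat)"
proof -
  have "card W \<le> card (\<Union>b\<in>I. F b)"
    using assms by (intro card_mono) auto
  also have "\<dots> \<le> (\<Sum>b\<in>I. card (F b))"
    using assms(1) by (rule card_UN_le)
  also have "\<dots> \<le> card I * u"
    using sum_bounded_above[of I "\<lambda>b. card (F b)" u] assms(4) by simp
  also have "\<dots> \<le> m * u"
    using assms(2) by simp
  finally show ?thesis .
qed

text \<open>Split on whether some pair \<open>x\<close>, \<open>y\<close> meets every member. If so,
  \<open>W\<close> is the union of the stars at \<open>x\<close> and \<open>y\<close>, and each star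
  is covered through the points of a member missing its centre. If not, every pair is missed by some
  member, so three rounds of covering lead from \<open>W\<close> to triples at a factor
  \<open>k\<close> each, and \<open>kw\<close> bounds the result.\<close>

lemma card_nonstar_intersecting_le:
  fixes W :: "'a set set"
  assumes fin: "finite W" and card: "\<And>A. A \<in> W \<Longrightarrow> finite A \<and> card A \<le> k"
    and inter: "\<And>A B. A \<in> W \<Longrightarrow> B \<in> W \<Longrightarrow> A \<inter> B \<noteq> {}"
    and nonstar: "\<And>x. \<exists>A\<in>W. x \<notin> A"
    and two: "\<And>x y. x \<noteq> y \<Longrightarrow> card {A \<in> W. {x, y} \<subseteq> A} \<le> u"
    and three: "\<And>x y z. x \<noteq> y \<Longrightarrow> x \<noteq> z \<Longrightarrow> y \<noteq> z \<Longrightarrow> card {A \<in> W. {x, y, z} \<subseteq> A} \<le> w"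
    and kw: "k * (k * (k * w)) \<le> 2 * k * u"
  shows "card W \<le> 2 * k * u"
proof -
  obtain B where B: "\<And>x. B x \<in> W" "\<And>x. x \<notin> B x"
    using nonstar by metis
  show ?thesis
  proof (cases "\<exists>x y. x \<noteq> y \<and> (\<forall>A\<in>W. x \<in> A \<or> y \<in> A)")
    case True
    then obtain x y where xy: "x \<noteq> y" "\<And>A. A \<in> W \<Longrightarrow> x \<in> A \<or> y \<in> A"
      by blast
    have through: "card {A \<in> W. c \<in> A} \<le> k * u" for c
    proof (rule card_le_of_cover)
      show "{A \<in> W. c \<in> A} \<subseteq> (\<Union>b\<in>B c. {A \<in> W. {c, b} \<subseteq> A})"
        using inter[OF B(1)] by fastforce
      show "card {A \<in> W. {c, b} \<subseteq> A} \<le> u" if "b \<in> B c" for b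
        using two[of c b] B(2) that by metis
    qed (use card B fin in auto)
    have "W = {A \<in> W. x \<in> A} \<union> {A \<in> W. y \<in> A}"
      using xy(2) by auto
    then have "card W \<le> card {A \<in> W. x \<in> A} + card {A \<in> W. y \<in> A}"
      by (metis card_Un_le)
    then show ?thesis
      using through[of x] through[of y] by simp
  next
    case False
    then obtain C where C: "\<And>x y. x \<noteq> y \<Longrightarrow> C x y \<in> W"
        "\<And>x y. x \<noteq> y \<Longrightarrow> x \<notin> C x y" "\<And>x y. x \<noteq> y \<Longrightarrow> y \<notin> C x y"
      by metis
    have through2: "card {A \<in> W. {x, y} \<subseteq> A} \<le> k * w" if "x \<noteq> y" for x y
    proof (rule card_le_of_cover)
      show "{A \<in> W. {x, y} \<subseteq> A} \<subseteq> (\<Union>b\<in>C x y. {A \<in> W. {x, y, b} \<subseteq> A})"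
        using inter[OF C(1)[OF that]] by fastforce
      show "card {A \<in> W. {x, y, b} \<subseteq> A} \<le> w" if "b \<in> C x y" for b
        using three[of x y b] C \<open>x \<noteq> y\<close> that by metis
    qed (use card C that fin in auto)
    have through1: "card {A \<in> W. x \<in> A} \<le> k * (k * w)" for x
    proof (rule card_le_of_cover)
      show "{A \<in> W. x \<in> A} \<subseteq> (\<Union>b\<in>B x. {A \<in> W. {x, b} \<subseteq> A})"
        using inter[OF B(1)] by fastforce
      show "card {A \<in> W. {x, b} \<subseteq> A} \<le> k * w" if "b \<in> B x" for b
        using through2[of x b] B(2) that by metis
    qed (use card B fin in auto)
    have "card W \<le> k * (k * (k * w))"
    proof (rule card_le_of_cover)
      \<comment> \<open>\<open>undefined\<close> stands for an arbitrary point; any member of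
        \<open>W\<close> would serve here.\<close>
      show "W \<subseteq> (\<Union>b\<in>B undefined. {A \<in> W. b \<in> A})"
        using inter[OF B(1)] by fastforce
    qed (use card B fin through1 in auto)
    then show ?thesis
      using kw by (rule order_trans)
  qed
qed

section \<open>Counting stable sets\<close>

definition stable_verts_containing :: "nat \<Rightarrow> nat \<Rightarrow> nat \<Rightarrow> nat set \<Rightarrow> nat set set" where
  "stable_verts_containing s n k X = {S \<in> stable_kneser_verts s n k. X \<subseteq> S}"

lemma finite_stable_kneser_verts [simp]: "finite (stable_kneser_verts s n k)"
  by (rule finite_subset[of _ "Pow {1..n}"]) (auto simp: stable_kneser_verts_def stable_set_def)

lemma finite_stable_verts_containing [simp]: "finite (stable_verts_containing s n k X)"
  by (simp add: stable_verts_containing_def)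

lemma stable_kneser_vertsD:
  assumes "S \<in> stable_kneser_verts s n k"
  shows "finite S" "card S = k" "S \<subseteq> {1..n}" "S \<noteq> {}"
  using assms by (auto simp: stable_kneser_verts_def stable_set_def dest: finite_subset)

lemma card_forbidden_le:
  assumes "0 < s" "s \<le> n" "w \<in> {1..n}"
  shows "card {z \<in> {1..n}. \<not> (int s \<le> \<bar>int z - int w\<bar> \<and> \<bar>int z - int w\<bar> \<le> int n - int s)}
    \<le> 2 * s - 1" (is "card ?Z \<le> _")
proof -
  \<comment> \<open>\<open>h z\<close> is the distance from \<open>w\<close> to \<open>z\<close>
    going upwards round the cycle. A forbidden \<open>z\<close> has \<open>h z < s\<close> or
    \<open>h z > n - s\<close>, which leaves \<open>s\<close> and \<open>s - 1\<close>
    values.\<close>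
  define h where "h z = (if w \<le> z then z - w else z + n - w)" for z
  have "inj_on h {1..n}"
    using assms(3) by (auto simp: inj_on_def h_def split: if_splits)
  then have "card ?Z = card (h ` ?Z)"
    by (intro card_image[symmetric]) (rule inj_on_subset, auto)
  also have "\<dots> \<le> card ({0..<s} \<union> {n - s + 1..<n})"
    using assms by (intro card_mono) (auto simp: h_def)
  also have "\<dots> \<le> s + (n - (n - s + 1))"
    by (rule order_trans[OF card_Un_le]) simp
  finally show ?thesis
    using assms by simp
qed

text \<open>Double counting of the exchanges of \<open>y\<close> for an admissible element \<open>z\<close>. For \<open>k = 1\<close> every
  singleton is stable, even if \<open>n < s\<close>.\<close>

lemma card_containing_insert_le:
  assumes "0 < s" "k = 1 \<or> s \<le> n" "0 < k" "finite X" "y \<notin> X"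
  shows "card (stable_verts_containing s n k (insert y X)) * (n - (k - 1) * (2 * s - 1))
    \<le> card (stable_verts_containing s n k X) * (k - card X)"
proof -
  \<comment> \<open>For a vertex \<open>S\<close> through \<open>y\<close>, \<open>Z S\<close>
    collects the possible replacements for \<open>y\<close>, with \<open>y\<close> itself among
    them. Each of the other \<open>k - 1\<close> elements rules out at most \<open>2 * s - 1\<close>
    candidates.\<close>
  define Z where "Z S = {z \<in> {1..n}. \<forall>w\<in>S - {y}.
    int s \<le> \<bar>int z - int w\<bar> \<and> \<bar>int z - int w\<bar> \<le> int n - int s}" for S
  let ?P = "Sigma (stable_verts_containing s n k (insert y X)) Z"
  let ?Q = "Sigma (stable_verts_containing s n k X) (\<lambda>S. S - X)"
  \<comment> \<open>Recording \<open>z\<close> makes the exchange injective: \<open>S\<close> is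
    recovered by removing \<open>z\<close> and restoring \<open>y\<close>.\<close>
  let ?g = "\<lambda>(S, z). (insert z (S - {y}), z)"
  have S: "finite S" "card S = k" "S \<subseteq> {1..n}" "y \<in> S" "X \<subseteq> S" "stable_set s n S"
    if "S \<in> stable_verts_containing s n k (insert y X)" for S
  proof -
    have *: "S \<in> stable_kneser_verts s n k" "insert y X \<subseteq> S"
      using that by (simp_all add: stable_verts_containing_def)
    show "finite S" "card S = k" "S \<subseteq> {1..n}"
      using stable_kneser_vertsD[OF *(1)] by blast+
    show "y \<in> S" "X \<subseteq> S"
      using *(2) by blast+
    show "stable_set s n S"
      using *(1) by (simp add: stable_kneser_verts_def)
  qed
  have notin: "z \<notin> S - {y}" if "z \<in> Z S" for z S
    using that \<open>0 < s\<close> by (force simp: Z_def)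
  have "n - (k - 1) * (2 * s - 1) \<le> card (Z S)"
    if "S \<in> stable_verts_containing s n k (insert y X)" for S
  proof -
    let ?F = "\<lambda>w. {z \<in> {1..n}. \<not> (int s \<le> \<bar>int z - int w\<bar> \<and> \<bar>int z - int w\<bar> \<le> int n - int s)}"
    have "card ({1..n} - Z S) \<le> (k - 1) * (2 * s - 1)"
    proof (rule card_le_of_cover)
      show "{1..n} - Z S \<subseteq> (\<Union>w\<in>S - {y}. ?F w)"
        by (auto simp: Z_def)
      show "card (?F w) \<le> 2 * s - 1" if "w \<in> S - {y}" for w
      proof -
        \<comment> \<open>For \<open>k = 1\<close> there is no such \<open>w\<close>; otherwise the
          hypothesis supplies \<open>s \<le> n\<close>.\<close>
        have "S \<noteq> {y}"
          using that by blast
        then have "k \<noteq> 1"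
          using S(2,4)[OF \<open>S \<in> _\<close>] by (metis card_1_singletonE singletonD)
        then show ?thesis
          using card_forbidden_le[of s n w] assms S(3)[OF \<open>S \<in> _\<close>] that by blast
      qed
    qed (use S[OF that] in auto)
    moreover have "card ({1..n} - Z S) = n - card (Z S)"
      by (subst card_Diff_subset) (auto simp: Z_def)
    ultimately show ?thesis
      by simp
  qed
  then have "(\<Sum>S\<in>stable_verts_containing s n k (insert y X). n - (k - 1) * (2 * s - 1))
      \<le> (\<Sum>S\<in>stable_verts_containing s n k (insert y X). card (Z S))"
    by (rule sum_mono)
  then have "card (stable_verts_containing s n k (insert y X)) * (n - (k - 1) * (2 * s - 1))
      \<le> card ?P"
    by (subst card_SigmaI) (auto simp: Z_def)
  also have "\<dots> \<le> card ?Q"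
  proof (rule card_inj_on_le)
    show "inj_on ?g ?P"
    proof (rule inj_onI, clarsimp)
      fix S T z
      assume *: "S \<in> stable_verts_containing s n k (insert y X)" "z \<in> Z S"
        "T \<in> stable_verts_containing s n k (insert y X)" "z \<in> Z T"
        "insert z (S - {y}) = insert z (T - {y})"
      then have "S - {y} = T - {y}"
        using notin[OF *(2)] notin[OF *(4)] by (metis insert_ident)
      then show "S = T"
        using S(4)[OF *(1)] S(4)[OF *(3)] by blast
    qed
    show "?g ` ?P \<subseteq> ?Q"
    proof clarsimp
      fix S z
      assume *: "S \<in> stable_verts_containing s n k (insert y X)" "z \<in> Z S"
      have "card (insert z (S - {y})) = k"
        using S[OF *(1)] notin[OF *(2)] \<open>0 < k\<close> by (simp add: card_insert_if)
      moreover have "stable_set s n (insert z (S - {y}))"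
        using S[OF *(1)] *(2) unfolding stable_set_def Z_def
        by (auto simp: abs_minus_commute)
      moreover have "X \<subseteq> S - {y}"
        using S(5)[OF *(1)] \<open>y \<notin> X\<close> by blast
      ultimately show "insert z (S - {y}) \<in> stable_verts_containing s n k X \<and> z \<notin> X"
        using notin[OF *(2)]
        by (auto simp: stable_verts_containing_def stable_kneser_verts_def)
    qed
    show "finite ?Q"
      by (rule finite_SigmaI) (simp, auto simp: stable_verts_containing_def dest: stable_kneser_vertsD(1))
  qed
  also have "\<dots> = (\<Sum>S\<in>stable_verts_containing s n k X. card (S - X))"
    by (rule card_SigmaI) (simp, auto simp: stable_verts_containing_def dest: stable_kneser_vertsD(1))
  also have "\<dots> = (\<Sum>S\<in>stable_verts_containing s n k X. k - card X)"
    by (rule sum.cong)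
      (auto simp: stable_verts_containing_def card_Diff_subset \<open>finite X\<close> dest: stable_kneser_vertsD(2))
  finally show ?thesis
    by simp
qed

text \<open>Rotation by one step keeps a difference or replaces it by its complement to
  \<open>n\<close>, and the stability condition is symmetric under this replacement.\<close>

lemma card_containing_rotate_le:
  assumes "x \<in> {1..n}"
  shows "card (stable_verts_containing s n k {x})
    \<le> card (stable_verts_containing s n k {if x = n then 1 else Suc x})"
proof (rule card_inj_on_le)
  define r where "r i = (if i = n then 1 else Suc i)" for i
  have inj: "inj_on r {1..n}"
    by (auto simp: inj_on_def r_def split: if_splits)
  have "r ` S \<in> stable_kneser_verts s n k" if "S \<in> stable_kneser_verts s n k" for S
  proof -
    have sub: "S \<subseteq> {1..n}"
      using stable_kneser_vertsD[OF that] by blast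
    have st: "int s \<le> \<bar>int i - int j\<bar> \<and> \<bar>int i - int j\<bar> \<le> int n - int s"
      if "i \<in> S" "j \<in> S" "i \<noteq> j" for i j
      using \<open>S \<in> _\<close> that by (auto simp: stable_kneser_verts_def stable_set_def)
    have "int s \<le> \<bar>int (r i) - int (r j)\<bar> \<and> \<bar>int (r i) - int (r j)\<bar> \<le> int n - int s"
      if "i \<in> S" "j \<in> S" "r i \<noteq> r j" for i j
      using st[of i j] that sub unfolding r_def by (auto split: if_splits)
    moreover have "card (r ` S) = k"
      using card_image[OF inj_on_subset[OF inj sub]] stable_kneser_vertsD[OF that] by simp
    moreover have "r ` S \<subseteq> {1..n}"
      using sub by (auto simp: r_def)
    ultimately show ?thesis
      using stable_kneser_vertsD(4)[OF that] by (auto simp: stable_kneser_verts_def stable_set_def)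
  qed
  then show "(`) r ` stable_verts_containing s n k {x}
      \<subseteq> stable_verts_containing s n k {if x = n then 1 else Suc x}"
    by (auto simp: stable_verts_containing_def r_def[symmetric])
  show "inj_on ((`) r) (stable_verts_containing s n k {x})"
  proof (rule inj_on_subset[OF inj_on_image_Pow[OF inj]])
    show "stable_verts_containing s n k {x} \<subseteq> Pow {1..n}"
      using stable_kneser_vertsD(3) by (fastforce simp only: stable_verts_containing_def)
  qed
qed simp

text \<open>Rotate upwards from \<open>x\<close> to \<open>n\<close>, across to \<open>1\<close>,
  and on to \<open>y\<close>. Exchanging \<open>x\<close> and \<open>y\<close> turns the inequality
  into equality.\<close>

lemma card_containing_singleton_le:
  assumes "x \<in> {1..n}" "y \<in> {1..n}"
  shows "card (stable_verts_containing s n k {x}) \<le> card (stable_verts_containing s n k {y})"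
proof -
  let ?N = "\<lambda>x. card (stable_verts_containing s n k {x})"
  have mono: "?N a \<le> ?N b" if "a \<le> b" "1 \<le> a" "b \<le> n" for a b
    using that
  proof (induction b rule: dec_induct)
    case (step b)
    then show ?case
      using card_containing_rotate_le[of b n s k] by (auto split: if_splits)
  qed simp
  have "?N x \<le> ?N n"
    using mono[of x n] assms by simp
  also have "\<dots> \<le> ?N 1"
    using card_containing_rotate_le[of n n s k] assms by simp
  also have "\<dots> \<le> ?N y"
    using mono[of 1 y] assms by simp
  finally show ?thesis .
qed

text \<open>Double counting of the incidences between elements and vertices, all elements having the
  same degree by rotation.\<close>

lemma card_stable_kneser_verts_mult:
  assumes "x \<in> {1..n}"
  shows "n * card (stable_verts_containing s n k {x}) = k * card (stable_kneser_verts s n k)"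
proof -
  let ?V = "stable_kneser_verts s n k"
  have "(\<Sum>y\<in>{1..n}. card (stable_verts_containing s n k {y}))
      = (\<Sum>y\<in>{1..n}. \<Sum>S\<in>?V. if y \<in> S then 1 else 0)"
    by (intro sum.cong) (simp_all add: stable_verts_containing_def sum.If_cases Int_def)
  also have "\<dots> = (\<Sum>S\<in>?V. \<Sum>y\<in>{1..n}. if y \<in> S then 1 else 0)"
    by (rule sum.swap)
  also have "\<dots> = (\<Sum>S\<in>?V. k)"
  proof (rule sum.cong)
    fix S assume "S \<in> ?V"
    then have "{1..n} \<inter> S = S" "card S = k"
      using stable_kneser_vertsD(2,3)[of S s n k] by (blast, blast)
    then show "(\<Sum>y\<in>{1..n}. if y \<in> S then 1 else 0) = k"
      by (simp add: sum.If_cases)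
  qed simp
  finally have "(\<Sum>y\<in>{1..n}. card (stable_verts_containing s n k {y})) = k * card ?V"
    by simp
  moreover have "(\<Sum>y\<in>{1..n}. card (stable_verts_containing s n k {y}))
      = (\<Sum>y\<in>{1..n}. card (stable_verts_containing s n k {x}))"
    using assms by (intro sum.cong) (auto intro!: antisym card_containing_singleton_le)
  ultimately show ?thesis
    by simp
qed

lemma stable_kneser_verts_nonempty:
  assumes "0 < n" "0 < k" "0 < s" "k = 1 \<or> k * s \<le> n"
  shows "stable_kneser_verts s n k \<noteq> {}"
proof (cases "k = 1")
  case True
  then have "{1} \<in> stable_kneser_verts s n k"
    using assms(1) by (simp add: stable_kneser_verts_def stable_set_def)
  then show ?thesis
    by blast
next
  case False
  then have n: "k * s \<le> n"
    using assms(4) by simp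
  \<comment> \<open>The progression \<open>1, 1 + s, ..., 1 + (k - 1) * s\<close>; the gap that
    closes the cycle is at least \<open>s\<close> because \<open>k * s \<le> n\<close>.\<close>
  define S where "S = (\<lambda>i. Suc (i * s)) ` {..<k}"
  have card: "card S = k"
    unfolding S_def using assms by (subst card_image) (auto simp: inj_on_def)
  have bound: "Suc i * s \<le> n" if "i < k" for i
    using n mult_le_mono1[of "Suc i" k s] that by simp
  have gap: "int s \<le> \<bar>int (Suc (i * s)) - int (Suc (j * s))\<bar>
      \<and> \<bar>int (Suc (i * s)) - int (Suc (j * s))\<bar> \<le> int n - int s" if "i < j" "j < k" for i j
  proof -
    have "Suc i * s \<le> j * s"
      using that by (intro mult_le_mono1) simp
    then have "int (i * s + s) \<le> int (j * s)"
      by (intro of_nat_mono) (simp add: add.commute)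
    moreover have "int (j * s + s) \<le> int n"
      using bound[OF that(2)] by (intro of_nat_mono) (simp add: add.commute)
    ultimately show ?thesis
      unfolding of_nat_Suc of_nat_add by linarith
  qed
  have "stable_set s n S"
    unfolding stable_set_def
  proof (intro conjI ballI impI)
    show "S \<noteq> {}"
      using assms(2) by (auto simp: S_def)
    show "S \<subseteq> {1..n}"
      using bound assms(3) by (fastforce simp: S_def)
  next
    fix a b assume "a \<in> S" "b \<in> S" "a \<noteq> b"
    then obtain i j where ij: "a = Suc (i * s)" "b = Suc (j * s)" "i < k" "j < k" "i \<noteq> j"
      by (auto simp: S_def)
    then consider "i < j" | "j < i"
      by linarith
    then have "int s \<le> \<bar>int a - int b\<bar> \<and> \<bar>int a - int b\<bar> \<le> int n - int s"
      using gap[of i j] gap[of j i] ij by cases (simp_all add: abs_minus_commute)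
    then show "int s \<le> \<bar>int a - int b\<bar>" "\<bar>int a - int b\<bar> \<le> int n - int s"
      by auto
  qed
  then show ?thesis
    using card by (auto simp: stable_kneser_verts_def)
qed

section \<open>Colourings\<close>

lemma chromatic_number_le:
  assumes "proper_coloring f G c"
  shows "chromatic_number G \<le> c"
  unfolding chromatic_number_def using assms by (intro Least_le) blast

text \<open>The intervals of length \<open>s\<close> starting at the elements of \<open>S\<close>
  are disjoint and lie between \<open>Min S\<close> and \<open>n + s\<close>; compare sizes.\<close>

lemma stable_kneser_Min_bound:
  assumes "S \<in> stable_kneser_verts s n k" "0 < k"
  shows "Min S + s * (k - 1) \<le> n"
proof -
  note S = stable_kneser_vertsD[OF assms(1)]
  have "k * s = (\<Sum>a\<in>S. card {a..<a + s})"
    using S by simp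
  also have "\<dots> = card (\<Union>a\<in>S. {a..<a + s})"
  proof (rule card_UN_disjoint[symmetric])
    show "\<forall>i\<in>S. \<forall>j\<in>S. i \<noteq> j \<longrightarrow> {i..<i + s} \<inter> {j..<j + s} = {}"
      using assms(1) by (fastforce simp: stable_kneser_verts_def stable_set_def)
  qed (use S in auto)
  also have "\<dots> \<le> card {Min S..<n + s}"
    using S by (intro card_mono) (auto intro: le_trans[OF Min_le] simp: subset_iff)
  finally have "k * s \<le> n + s - Min S"
    by simp
  moreover have "Min S \<in> S"
    using S by simp
  then have "Min S \<le> n"
    using S(3) atLeastAtMost_iff by blast
  moreover have "k * s = s + s * (k - 1)"
    using assms(2) by (cases k) simp_all
  ultimately show ?thesis
    by simp
qed

text \<open>Disjoint sets have different minima. The number of colours bounds the chromatic number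
  in the final count, and the existence of a colouring ensures that the \<open>LEAST\<close>
  defining it is attained.\<close>

lemma proper_coloring_Min:
  assumes "0 < k"
  shows "proper_coloring Min (stable_kneser_graph s n k) (n - s * (k - 1))"
  unfolding proper_coloring_def
proof (intro conjI)
  have "Min S \<in> {1..n - s * (k - 1)}" if "S \<in> stable_kneser_verts s n k" for S
  proof -
    have "Min S \<in> {1..n}"
      using stable_kneser_vertsD[OF that] Min_in by blast
    then show ?thesis
      using stable_kneser_Min_bound[OF that assms] by simp
  qed
  then show "Min ` pverts (stable_kneser_graph s n k) \<subseteq> {1..n - s * (k - 1)}"
    by (auto simp: stable_kneser_graph_def)
  have "Min S \<noteq> Min T" if "S \<in> stable_kneser_verts s n k" "T \<in> stable_kneser_verts s n k"
    "S \<inter> T = {}" for S T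
    using that(3) Min_in stable_kneser_vertsD[OF that(1)] stable_kneser_vertsD[OF that(2)]
    by (metis disjoint_iff)
  then show "\<forall>(S, T)\<in>parcs (stable_kneser_graph s n k). Min S \<noteq> Min T"
    by (auto simp: stable_kneser_graph_def)
qed

text \<open>\<open>A\<close> and \<open>B\<close> avoid \<open>i\<close> with extreme values of \<open>g\<close>. If \<open>g B\<close> and \<open>g A\<close> were closer than
  \<open>(t - 2) * d\<close>, then one colour for the sets through \<open>i\<close> and intervals of length \<open>d\<close> for the others
  would give a colouring with \<open>t - 1\<close> colours. A member of the star that is disjoint from both
  would force exactly this.\<close>

lemma card_star_window_le:
  fixes g :: "nat set \<Rightarrow> nat" and s n k :: nat
  defines "V \<equiv> stable_kneser_verts s n k"
  assumes dist: "\<And>S T. S \<in> V \<Longrightarrow> T \<in> V \<Longrightarrow> S \<inter> T = {} \<Longrightarrow>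
      int d \<le> \<bar>int (g S) - int (g T)\<bar> \<and> \<bar>int (g S) - int (g T)\<bar> \<le> int p - int d"
    and d: "0 < d" "d \<le> p" "p < chromatic_number (stable_kneser_graph s n k) * d"
    and star: "\<And>S. S \<in> V \<Longrightarrow> g S < l \<Longrightarrow> i \<in> S"
    and two: "\<And>x y. x \<noteq> y \<Longrightarrow> card (stable_verts_containing s n k {x, y}) \<le> u"
  shows "card {S \<in> V. g S < l} \<le> 2 * k * u"
proof -
  define t where "t = chromatic_number (stable_kneser_graph s n k)"
  define R where "R = {S \<in> V. i \<notin> S}"
  have finR: "finite R"
    by (simp add: R_def V_def)
  have t2: "2 \<le> t"
  proof (rule ccontr)
    assume "\<not> 2 \<le> t"
    then have "t * d \<le> 1 * d"
      by (intro mult_le_mono1) simp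
    then show False
      using d unfolding t_def by linarith
  qed
  \<comment> \<open>If every vertex contained \<open>i\<close>, there would be no edges and one
    colour would suffice.\<close>
  have "R \<noteq> {}"
  proof
    assume "R = {}"
    then have "proper_coloring (\<lambda>_. 1) (stable_kneser_graph s n k) 1"
      by (auto simp: proper_coloring_def stable_kneser_graph_def R_def V_def)
    then show False
      using t2 chromatic_number_le t_def by fastforce
  qed
  obtain A where A: "A \<in> R" "\<And>S. S \<in> R \<Longrightarrow> g S \<le> g A"
  proof -
    have "Max (g ` R) \<in> g ` R"
      using finR \<open>R \<noteq> {}\<close> by simp
    then obtain A where "A \<in> R" "g A = Max (g ` R)"
      by force
    then show ?thesis
      using that finR by simp
  qed
  obtain B where B: "B \<in> R" "\<And>S. S \<in> R \<Longrightarrow> g B \<le> g S"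
  proof -
    have "Min (g ` R) \<in> g ` R"
      using finR \<open>R \<noteq> {}\<close> by simp
    then obtain B where "B \<in> R" "g B = Min (g ` R)"
      by force
    then show ?thesis
      using that finR by simp
  qed
  define q where "q = (g A - g B) div d + 2"
  have "proper_coloring (\<lambda>S. if i \<in> S then 1 else (g S - g B) div d + 2)
      (stable_kneser_graph s n k) q"
    unfolding proper_coloring_def
  proof (intro conjI)
    have "(g S - g B) div d + 2 \<in> {1..q}" if "S \<in> R" for S
      using A(2)[OF that] by (auto simp: q_def intro!: div_le_mono)
    then show "(\<lambda>S. if i \<in> S then 1 else (g S - g B) div d + 2)
        ` pverts (stable_kneser_graph s n k) \<subseteq> {1..q}"
      by (auto simp: stable_kneser_graph_def R_def V_def q_def)
    have "(g S - g B) div d \<noteq> (g T - g B) div d" if "S \<in> R" "T \<in> R" "S \<inter> T = {}" for S T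
    proof
      assume eq: "(g S - g B) div d = (g T - g B) div d"
      have "g S - g B = (g S - g B) div d * d + (g S - g B) mod d"
        "g T - g B = (g S - g B) div d * d + (g T - g B) mod d"
        by (simp, subst eq, simp)
      moreover have "(g S - g B) mod d < d" "(g T - g B) mod d < d"
        using d by simp_all
      moreover have "int d \<le> \<bar>int (g S) - int (g T)\<bar>"
        using dist[of S T] that by (simp add: R_def)
      ultimately show False
        using B(2)[OF that(1)] B(2)[OF that(2)] by linarith
    qed
    then show "\<forall>(S, T)\<in>parcs (stable_kneser_graph s n k).
        (if i \<in> S then 1 else (g S - g B) div d + 2) \<noteq> (if i \<in> T then 1 else (g T - g B) div d + 2)"
      by (auto simp: stable_kneser_graph_def R_def V_def)
  qed
  then have "t \<le> q"
    unfolding t_def by (rule chromatic_number_le)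
  then have "t - 2 \<le> (g A - g B) div d"
    by (simp add: q_def)
  then have "(t - 2) * d \<le> g A - g B"
    using d by (simp add: less_eq_div_iff_mult_less_eq)
  moreover have "t * d = (t - 2) * d + 2 * d"
    using t2 by (metis add_mult_distrib le_add_diff_inverse2)
  \<comment> \<open>On the circle of length \<open>p\<close>, the arc from \<open>A\<close> up
    through \<open>0\<close> to \<open>B\<close> is thus shorter than \<open>2 * d\<close>.\<close>
  ultimately have spread: "p < g A - g B + 2 * d"
    using d unfolding t_def by linarith
  have "g B \<le> g A"
    using A B by simp
  have "{S \<in> V. g S < l} \<subseteq> (\<Union>b\<in>A \<union> B. stable_verts_containing s n k {i, b})"
  proof
    fix S assume "S \<in> {S \<in> V. g S < l}"
    then have S: "S \<in> V" "g S < l" "i \<in> S"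
      using star by auto
    have lB: "l \<le> g B"
      using star[of B] B(1) by (auto simp: R_def not_less[symmetric])
    \<comment> \<open>The window lies below \<open>B\<close>, on that short arc. A member disjoint
      from both sets would need distance at least \<open>d\<close> from each end.\<close>
    have "S \<inter> A \<noteq> {} \<or> S \<inter> B \<noteq> {}"
    proof (rule ccontr)
      assume "\<not> ?thesis"
      then have "int d \<le> \<bar>int (g S) - int (g B)\<bar>" "\<bar>int (g S) - int (g A)\<bar> \<le> int p - int d"
        using dist[of S A] dist[of S B] S(1) A(1) B(1) by (auto simp: R_def)
      then show False
        using spread \<open>g B \<le> g A\<close> S(2) lB by linarith
    qed
    then show "S \<in> (\<Union>b\<in>A \<union> B. stable_verts_containing s n k {i, b})"
      using S by (auto simp: stable_verts_containing_def V_def)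
  qed
  moreover have "card (A \<union> B) \<le> 2 * k" "finite (A \<union> B)"
    using card_Un_le[of A B] A(1) B(1) stable_kneser_vertsD[of A s n k] stable_kneser_vertsD[of B s n k]
    by (auto simp: R_def V_def)
  moreover have "card (stable_verts_containing s n k {i, b}) \<le> u" if "b \<in> A \<union> B" for b
    using two[of i b] A(1) B(1) that by (auto simp: R_def)
  ultimately show ?thesis
    using card_le_of_cover[of "A \<union> B" "2 * k" "\<lambda>b. stable_verts_containing s n k {i, b}" u]
      finite_stable_verts_containing by blast
qed


text \<open>Values in one interval of length \<open>d\<close> differ by less than \<open>d\<close>,
  so a class is intersecting. Without a common element the covering bound applies; with one, the
  circle is rotated so that the class becomes an initial window.\<close>

lemma card_color_class_le:
  fixes g :: "nat set \<Rightarrow> nat" and s n k :: nat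
  defines "V \<equiv> stable_kneser_verts s n k"
  assumes dist: "\<And>S T. S \<in> V \<Longrightarrow> T \<in> V \<Longrightarrow> S \<inter> T = {} \<Longrightarrow>
      int d \<le> \<bar>int (g S) - int (g T)\<bar> \<and> \<bar>int (g S) - int (g T)\<bar> \<le> int p - int d"
    and less: "\<And>S. S \<in> V \<Longrightarrow> g S < p"
    and d: "0 < d" "d \<le> p" "p < chromatic_number (stable_kneser_graph s n k) * d"
    and two: "\<And>x y. x \<noteq> y \<Longrightarrow> card (stable_verts_containing s n k {x, y}) \<le> u"
    and three: "\<And>x y z. x \<noteq> y \<Longrightarrow> x \<noteq> z \<Longrightarrow> y \<noteq> z \<Longrightarrow>
      card (stable_verts_containing s n k {x, y, z}) \<le> w"
    and kw: "k * (k * (k * w)) \<le> 2 * k * u"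
  shows "card {S \<in> V. g S div d = j} \<le> 2 * k * u"
proof (cases "\<exists>i. \<forall>S\<in>{S \<in> V. g S div d = j}. i \<in> S")
  case False
  have sub: "card {A \<in> {S \<in> V. g S div d = j}. X \<subseteq> A} \<le> card (stable_verts_containing s n k X)" for X
    by (intro card_mono) (auto simp: stable_verts_containing_def V_def)
  show ?thesis
  proof (rule card_nonstar_intersecting_le)
    show "S \<inter> T \<noteq> {}" if "S \<in> {S \<in> V. g S div d = j}" "T \<in> {S \<in> V. g S div d = j}" for S T
    proof
      assume "S \<inter> T = {}"
      then have "int d \<le> \<bar>int (g S) - int (g T)\<bar>"
        using dist[of S T] that by simp
      moreover have "g S = j * d + g S mod d" "g T = j * d + g T mod d"
        using that div_mult_mod_eq[of "g S" d] div_mult_mod_eq[of "g T" d] by simp_all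
      moreover have "g S mod d < d" "g T mod d < d"
        using d by simp_all
      ultimately show False
        by linarith
    qed
    show "finite A \<and> card A \<le> k" if "A \<in> {S \<in> V. g S div d = j}" for A
      using that stable_kneser_vertsD[of A s n k] by (simp add: V_def)
    show "card {A \<in> {S \<in> V. g S div d = j}. {x, y} \<subseteq> A} \<le> u" if "x \<noteq> y" for x y
      using sub two[OF that] by (rule order_trans)
    show "card {A \<in> {S \<in> V. g S div d = j}. {x, y, z} \<subseteq> A} \<le> w"
      if "x \<noteq> y" "x \<noteq> z" "y \<noteq> z" for x y z
      using sub three[OF that] by (rule order_trans)
  qed (use False kw in \<open>auto simp: V_def\<close>)
next
  case True
  then obtain i where i: "\<And>S. S \<in> V \<Longrightarrow> g S div d = j \<Longrightarrow> i \<in> S"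
    by blast
  show ?thesis
  proof (cases "j * d \<le> p")
    case False
    have "g S div d \<noteq> j" if "S \<in> V" for S
      using less[OF that] False by (metis div_times_less_eq_dividend le_less_trans less_imp_le)
    then have "{S \<in> V. g S div d = j} = {}"
      by blast
    then show ?thesis
      by (metis card.empty zero_le)
  next
    case True
    \<comment> \<open>Rotation of the circle by \<open>j * d\<close>: a difference stays or becomes
      its complement to \<open>p\<close>, so \<open>dist\<close> survives.\<close>
    define h where "h S = (if j * d \<le> g S then g S - j * d else g S + p - j * d)" for S
    \<comment> \<open>The last interval may be cut short by \<open>p\<close>.\<close>
    define l where "l = min d (p - j * d)"
    have iff: "g S div d = j \<longleftrightarrow> h S < l" if "S \<in> V" for S
    proof -
      have "g S div d = j \<longleftrightarrow> j * d \<le> g S \<and> g S < j * d + d"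
        using d(1) div_nat_eqI[of d j "g S"] div_times_less_eq_dividend[of "g S" d]
          dividend_less_div_times[of d "g S"] by (auto simp: mult.commute add.commute)
      also have "\<dots> \<longleftrightarrow> h S < l"
        using less[OF that] True by (auto simp: h_def l_def)
      finally show ?thesis .
    qed
    have "card {S \<in> V. h S < l} \<le> 2 * k * u"
      unfolding V_def
    proof (rule card_star_window_le[OF _ d])
      show "int d \<le> \<bar>int (h S) - int (h T)\<bar> \<and> \<bar>int (h S) - int (h T)\<bar> \<le> int p - int d"
        if "S \<in> stable_kneser_verts s n k" "T \<in> stable_kneser_verts s n k" "S \<inter> T = {}" for S T
        using dist[of S T] less[of S] less[of T] that True unfolding h_def V_def[symmetric]
        by (auto split: if_splits)
      show "i \<in> S" if "S \<in> stable_kneser_verts s n k" "h S < l" for S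
        using i iff that by (simp add: V_def)
    qed (use two in blast)
    moreover have "{S \<in> V. g S div d = j} = {S \<in> V. h S < l}"
      using iff by blast
    ultimately show ?thesis
      by simp
  qed
qed

section \<open>The lower bound\<close>

text \<open>Here \<open>c = k - 1\<close> and \<open>e = s - 1\<close>, which frees the hypothesis
  of truncated subtraction. The three parts serve, in order, to compare triple counts with pair
  counts, to get \<open>k * s \<le> n\<close>, and to contradict the final count.\<close>

lemma numerical_bounds:
  fixes n c e :: nat
  assumes "n \<ge> 2 * (c + 1)^2 * c + e * (c + 1) * c + 1"
  shows "(c + 1)^2 * (c - 1) + c * (2 * e + 1) < n"
    and "0 < c \<Longrightarrow> (c + 1) * (e + 1) \<le> n"
    and "0 < c \<Longrightarrow> 2 * (c + 1)^2 * c * (n - (e + 1) * c) < n * (n - c * (2 * e + 1))"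
proof -
  have "c \<le> (c + 1)^2 * c"
    by (simp add: power2_eq_square)
  moreover have "(c + 1)^2 * (c - 1) \<le> (c + 1)^2 * c"
    by (intro mult_le_mono2) simp
  moreover have ec: "2 * (e * c) \<le> e * (c + 1) * c"
    by (cases c) (simp_all add: algebra_simps)
  moreover have "c * (2 * e + 1) = 2 * (e * c) + c" "2 * (c + 1)^2 * c = 2 * ((c + 1)^2 * c)"
    by simp_all
  ultimately show first: "(c + 1)^2 * (c - 1) + c * (2 * e + 1) < n"
    using assms by linarith
  assume "0 < c"
  then have c: "1 \<le> c"
    by simp
  have "e * 1 \<le> e * c"
    using c by (intro mult_le_mono2)
  moreover have "1 * c \<le> (c + 1)^2 * c"
    by (intro mult_le_mono1) simp
  moreover have "(c + 1) * (e + 1) = e * c + c + e + 1" "2 * (c + 1)^2 * c = 2 * ((c + 1)^2 * c)"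
    by simp_all
  ultimately show "(c + 1) * (e + 1) \<le> n"
    using assms ec by linarith
  obtain r where r: "n = 2 * (c + 1)^2 * c + e * (c + 1) * c + 1 + r"
    using assms le_Suc_ex by blast
  \<comment> \<open>\<open>T\<close> is the bound on the chromatic number from colouring by minima,
    taken in the integers. Then \<open>n * (n - c * (2 * e + 1))\<close> equals
    \<open>T * (T + c) - e * c^2 * (e + 1)\<close>, and inserting the explicit value of
    \<open>T + c\<close> reduces the claim to \<open>e + 1 < T\<close>.\<close>
  define T where "T = int n - (int e + 1) * int c"
  have T: "T = 2 * (int c + 1)^2 * int c + int e * (int c)^2 - int c + 1 + int r"
    unfolding T_def r by (simp add: algebra_simps power2_eq_square)
  have "int e * 1 \<le> int e * (int c)^2"
    using c by (intro mult_left_mono) simp_all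
  moreover have "1 * int c \<le> (int c + 1)^2 * int c"
    using c by (intro mult_right_mono) simp_all
  moreover have "1 * 1 \<le> (int c + 1)^2 * int c"
    using c by (intro mult_mono) simp_all
  ultimately have "int e + 1 < T"
    unfolding T using of_nat_0_le_iff[of r] by linarith
  moreover have "T * 1 \<le> T * (1 + int r)"
    using \<open>int e + 1 < T\<close> by (intro mult_left_mono) simp_all
  moreover have "int e * (int c)^2 * (int e + 1) \<le> int e * (int c)^2 * T"
    using \<open>int e + 1 < T\<close> by (intro mult_left_mono) simp_all
  ultimately have "0 < T * (1 + int r) + int e * (int c)^2 * T - int e * (int c)^2 * (int e + 1)"
    using of_nat_0_le_iff[of e] by linarith
  also have "\<dots> = T * (2 * (int c + 1)^2 * int c + int e * (int c)^2 + 1 + int r)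
      - int e * (int c)^2 * (int e + 1) - 2 * (int c + 1)^2 * int c * T"
    by (simp add: algebra_simps)
  also have "2 * (int c + 1)^2 * int c + int e * (int c)^2 + 1 + int r = T + int c"
    by (simp add: T)
  also have "T * (T + int c) - int e * (int c)^2 * (int e + 1)
      = int n * (int n - int c * (2 * int e + 1))"
    unfolding T_def by (simp add: algebra_simps power2_eq_square)
  finally have "2 * (int c + 1)^2 * int c * T < int n * (int n - int c * (2 * int e + 1))"
    by simp
  moreover have T_nat: "int (n - (e + 1) * c) = T"
  proof -
    have "int ((e + 1) * c) \<le> int n"
      using \<open>int e + 1 < T\<close> by (simp add: T_def algebra_simps)
    then show ?thesis
      by (simp add: T_def of_nat_diff del: of_nat_mult mult_Suc) (simp add: algebra_simps)
  qed
  moreover have diff: "int (n - c * (2 * e + 1)) = int n - int c * (2 * int e + 1)"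
    using first by (simp add: of_nat_diff algebra_simps)
  ultimately have "int (2 * (c + 1)^2 * c * (n - (e + 1) * c)) < int (n * (n - c * (2 * e + 1)))"
    by (simp only: T_nat diff of_nat_mult of_nat_power of_nat_add of_nat_numeral of_nat_1)
  then show "2 * (c + 1)^2 * c * (n - (e + 1) * c) < n * (n - c * (2 * e + 1))"
    by linarith
qed

text \<open>If \<open>p < t * d\<close>, the colour classes bound the number of vertices above and
  the exchanges bound it below, both by multiples of the largest pair count \<open>u\<close>, and
  the two bounds clash.\<close>

lemma chromatic_number_mult_le:
  assumes "0 < k" "0 < s" "n \<ge> 2 * k^2 * (k - 1) + (s - 1) * k * (k - 1) + 1"
    and hom: "graph_hom F (stable_kneser_graph s n k) (circular_clique p d)" and d: "0 < d" "d \<le> p"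
  shows "chromatic_number (stable_kneser_graph s n k) * d \<le> p"
proof (rule ccontr)
  define t where "t = chromatic_number (stable_kneser_graph s n k)"
  define V where "V = stable_kneser_verts s n k"
  define N where "N X = card (stable_verts_containing s n k X)" for X
  \<comment> \<open>\<open>D\<close> bounds the candidates excluded by the \<open>k - 1\<close>
    elements kept in an exchange.\<close>
  define D where "D = (k - 1) * (2 * s - 1)"
  assume "\<not> ?thesis"
  then have p: "p < t * d"
    by (simp add: t_def)
  obtain c e where ce: "k = c + 1" "s = e + 1"
    using assms(1,2) by (metis Suc_eq_plus1 gr0_implies_Suc)
  have n: "n \<ge> 2 * (c + 1)^2 * c + e * (c + 1) * c + 1"
    using assms(3) by (simp add: ce)
  have D: "D = c * (2 * e + 1)"
    by (simp add: D_def ce)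
  note num = numerical_bounds[OF n]
  have nD: "k^2 * (k - 2) < n - D"
    using num(1) by (simp add: D ce)
  have "0 < n"
    using n by simp
  have ks: "k = 1 \<or> k * s \<le> n"
    using num(2) by (cases "c = 0") (simp_all add: ce)
  have sn: "k = 1 \<or> s \<le> n"
    using ks assms(1) by (cases k) auto
  have "V \<noteq> {}"
    unfolding V_def using \<open>0 < n\<close> assms(1,2) ks by (intro stable_kneser_verts_nonempty)
  then have "0 < card V"
    by (simp add: V_def card_gt_0_iff)
  have bounded: "N X \<le> card V" for X
    unfolding N_def V_def by (intro card_mono) (auto simp: stable_verts_containing_def)
  have extend: "N (insert y X) * (n - D) \<le> N X * (k - card X)" if "finite X" "y \<notin> X" for X y
    unfolding N_def D_def using card_containing_insert_le[OF assms(2) sn assms(1) that] .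

  \<comment> \<open>Both maxima run over all natural numbers, where points outside
    \<open>{1..n}\<close> give count \<open>0\<close>; they exist because \<open>N\<close> is at
    most \<open>card V\<close>.\<close>
  obtain x0 y0 where xy: "x0 \<noteq> y0" "\<And>x y. x \<noteq> y \<Longrightarrow> N {x, y} \<le> N {x0, y0}"
    using ex_has_greatest_nat[of "\<lambda>(x, y). x \<noteq> y" "(0::nat, 1::nat)"
        "\<lambda>(x, y). N {x, y}" "Suc (card V)"] bounded
    by (auto simp: less_Suc_eq_le)
  define u where "u = N {x0, y0}"
  obtain x1 y1 z1 where xyz: "x1 \<noteq> y1" "x1 \<noteq> z1" "y1 \<noteq> z1"
    "\<And>x y z. x \<noteq> y \<Longrightarrow> x \<noteq> z \<Longrightarrow> y \<noteq> z \<Longrightarrow> N {x, y, z} \<le> N {x1, y1, z1}"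
    using ex_has_greatest_nat[of "\<lambda>(x, y, z). x \<noteq> y \<and> x \<noteq> z \<and> y \<noteq> z" "(0::nat, 1::nat, 2::nat)"
        "\<lambda>(x, y, z). N {x, y, z}" "Suc (card V)"] bounded
    by (auto simp: less_Suc_eq_le)
  define w where "w = N {x1, y1, z1}"
  \<comment> \<open>Exchange one point of the triple. For \<open>k \<le> 2\<close> the truncated
    \<open>k - 2\<close> is \<open>0\<close>, which forces \<open>w = 0\<close>.\<close>
  have w: "w * (n - D) \<le> u * (k - 2)"
  proof -
    have "w * (n - D) \<le> N {y1, z1} * (k - 2)"
      using extend[of "{y1, z1}" x1] xyz by (simp add: w_def numeral_2_eq_2)
    also have "\<dots> \<le> u * (k - 2)"
      using xy(2)[of y1 z1] xyz by (simp add: u_def)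
    finally show ?thesis .
  qed
  have kw: "k * (k * (k * w)) \<le> 2 * k * u"
  proof (cases "k - 2 = 0")
    case True
    then have "w = 0"
      using w nD by simp
    then show ?thesis
      by simp
  next
    case False
    have "k^2 * w * (k - 2) \<le> w * (n - D)"
      using nD mult_le_mono2[of "k^2 * (k - 2)" "n - D" w] by (simp add: mult_ac)
    also note w
    finally have "k^2 * w \<le> u"
      using False by simp
    then have "k * (k^2 * w) \<le> k * (2 * u)"
      by (intro mult_le_mono2) simp
    then show ?thesis
      by (simp add: power2_eq_square mult_ac)
  qed

  \<comment> \<open>Colours are shifted to start at \<open>0\<close>, so that \<open>div d\<close>
    cuts the circle into intervals.\<close>
  define g where "g S = F S - 1" for S
  have F: "F S \<in> {1..p}" if "S \<in> V" for S
    using hom that by (auto simp: graph_hom_def stable_kneser_graph_def circular_clique_def V_def)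
  have dist: "int d \<le> \<bar>int (g S) - int (g T)\<bar> \<and> \<bar>int (g S) - int (g T)\<bar> \<le> int p - int d"
    if "S \<in> V" "T \<in> V" "S \<inter> T = {}" for S T
  proof -
    have "int d \<le> \<bar>int (F S) - int (F T)\<bar> \<and> \<bar>int (F S) - int (F T)\<bar> \<le> int p - int d"
      using hom that by (auto simp: graph_hom_def stable_kneser_graph_def circular_clique_def V_def)
    then show ?thesis
      using F[OF that(1)] F[OF that(2)] by (simp add: g_def of_nat_diff)
  qed
  have less: "g S < p" if "S \<in> V" for S
    using F[OF that] by (auto simp: g_def)
  have class_le: "card {S \<in> V. g S div d = j} \<le> 2 * k * u" for j
    unfolding V_def
    by (rule card_color_class_le[OF dist less d p[unfolded t_def] _ _ kw, unfolded V_def])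
      (use xy xyz in \<open>auto simp: N_def u_def w_def\<close>)
  \<comment> \<open>Since \<open>g S < p < t * d\<close>, only class indices below \<open>t\<close>
    occur.\<close>
  have "card V \<le> t * (2 * k * u)"
  proof (rule card_le_of_cover)
    show "V \<subseteq> (\<Union>j\<in>{..<t}. {S \<in> V. g S div d = j})"
      using less p d(1) by (fastforce intro: less_mult_imp_div_less)
  qed (use class_le in \<open>auto simp: V_def\<close>)
  have "u \<noteq> 0"
    using \<open>card V \<le> _\<close> \<open>0 < card V\<close> by (metis mult_0_right not_less)
  have "t \<le> n - (e + 1) * c"
    using chromatic_number_le[OF proper_coloring_Min[OF assms(1), of s n]] by (simp add: t_def ce)
  \<comment> \<open>\<open>y0\<close> may lie outside \<open>{1..n}\<close>, and then no vertex
    contains it.\<close>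
  have "N {y0} \<le> N {1}"
  proof (cases "y0 \<in> {1..n}")
    case True
    then show ?thesis
      unfolding N_def by (intro card_containing_singleton_le) auto
  next
    case False
    then have "stable_verts_containing s n k {y0} = {}"
      using stable_kneser_vertsD(3) by (fastforce simp only: stable_verts_containing_def)
    then show ?thesis
      by (simp add: N_def)
  qed
  moreover have "u * (n - D) \<le> N {y0} * c"
    using extend[of "{y0}" x0] xy(1) by (simp add: u_def ce)
  ultimately have u: "u * (n - D) \<le> N {1} * c"
    by (meson mult_le_mono1 order_trans)
  \<comment> \<open>For \<open>k = 1\<close> the exchange bound would force
    \<open>u = 0\<close>.\<close>
  then have "0 < c"
    using \<open>u \<noteq> 0\<close> nD by (cases c) auto
  \<comment> \<open>The class bound on \<open>card V\<close> is fed back into the exchange bound.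
    Both ends then carry the positive factor \<open>u\<close>, and the last numerical bound
    contradicts what is left.\<close>
  have "u * (n * (n - D)) \<le> n * N {1} * c"
    using mult_le_mono2[OF u, of n] by (simp add: mult_ac)
  also have "n * N {1} = k * card V"
    unfolding N_def V_def using \<open>0 < n\<close> by (intro card_stable_kneser_verts_mult) auto
  also have "k * card V * c \<le> k * (t * (2 * k * u)) * c"
    using \<open>card V \<le> _\<close> by simp
  also have "\<dots> = u * (2 * k^2 * c * t)"
    by (simp add: power2_eq_square mult_ac)
  also have "\<dots> \<le> u * (2 * k^2 * c * (n - (e + 1) * c))"
    using \<open>t \<le> _\<close> by simp
  also have "\<dots> < u * (n * (n - D))"
    using num(3)[OF \<open>0 < c\<close>] \<open>u \<noteq> 0\<close> by (simp add: ce D)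
  finally show False
    by simp
qed

theorem theorem12:
  fixes n k s :: nat
  assumes "0 < n" and "0 < k" and "0 < s"
    and "n \<ge> 2 * k^2 * (k - 1) + (s - 1) * k * (k - 1) + 1"
  shows "circular_chromatic_number (stable_kneser_graph s n k) =
         real (chromatic_number (stable_kneser_graph s n k))"
proof -
  let ?G = "stable_kneser_graph s n k"
  let ?t = "chromatic_number ?G"
  have "\<exists>f. proper_coloring f ?G ?t"
    unfolding chromatic_number_def by (rule LeastI) (use proper_coloring_Min[OF assms(2)] in blast)
  then obtain f where f: "proper_coloring f ?G ?t"
    by blast
  have "k = 1 \<or> k * s \<le> n"
    using numerical_bounds(2)[of "k - 1" "s - 1" n] assms
    by (cases "k = 1") simp_all
  then have verts: "stable_kneser_verts s n k \<noteq> {}"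
    using assms(1-3) by (intro stable_kneser_verts_nonempty)
  have range: "f S \<in> {1..?t}" if "S \<in> stable_kneser_verts s n k" for S
    using f that by (auto simp: proper_coloring_def stable_kneser_graph_def)
  \<comment> \<open>This is the condition \<open>d \<le> p\<close> for the fraction with
    \<open>p = ?t\<close> and \<open>d = 1\<close>.\<close>
  then have "1 \<le> ?t"
    using verts by fastforce
  \<comment> \<open>An ordinary colouring with \<open>?t\<close> colours is a homomorphism to the
    circular clique with \<open>p = ?t\<close> and \<open>d = 1\<close>, so the infimum is attained
    there.\<close>
  have "1 \<le> \<bar>int (f S) - int (f T)\<bar> \<and> \<bar>int (f S) - int (f T)\<bar> \<le> int ?t - 1"
    if "S \<in> stable_kneser_verts s n k" "T \<in> stable_kneser_verts s n k" "S \<inter> T = {}" for S T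
  proof -
    have "f S \<noteq> f T"
      using f that by (auto simp: proper_coloring_def stable_kneser_graph_def)
    then show ?thesis
      using range[OF that(1)] range[OF that(2)] by auto
  qed
  then have "graph_hom f ?G (circular_clique ?t 1)"
    unfolding graph_hom_def using range
    by (auto simp del: atLeastAtMost_iff simp: stable_kneser_graph_def circular_clique_def)
  show ?thesis
    unfolding circular_chromatic_number_def
  proof (rule cInf_eq_minimum)
    show "real ?t \<in> {real p / real d |p d. 0 < d \<and> d \<le> p \<and>
        (\<exists>f. graph_hom f ?G (circular_clique p d))}"
      using \<open>graph_hom f ?G _\<close> \<open>1 \<le> ?t\<close> 
      by (intro CollectI exI[of _ ?t] exI[of _ "1::nat"]) auto
    fix x assume "x \<in> {real p / real d |p d. 0 < d \<and> d \<le> p \<and>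
        (\<exists>f. graph_hom f ?G (circular_clique p d))}"
    then obtain p d F where x: "x = real p / real d" "0 < d" "d \<le> p"
        "graph_hom F ?G (circular_clique p d)"
      by blast
    then have "real (?t * d) \<le> real p"
      using chromatic_number_mult_le[OF assms(2-4)] of_nat_le_iff by blast
    then show "real ?t \<le> x"
      using x by (simp add: pos_le_divide_eq)
  qed
qed

end
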